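(* Let $\mathcal{A}=\{(U_i,E_i,D_i)\}_{i\in I}$ be a smooth autoencoder atlas on $M$. The tangent bundle $\mathcal{T}_{\mathcal{A}}$ of the atlas is a rank-$d$ vector bundle over $M$ with transition functions $\{g_{ji}\}$.
   Context: $M$ is a smooth compact $d$-dimensional manifold without boundary, embedded in $\mathbb{R}^N$. A smooth autoencoder chart on $M$ is a triple $(U,E,D)$ with $U\subset M$ open, $E:U\to Z\subset\mathbb{R}^d$ smooth and a diffeomorphism onto its image, $D:Z\to M$ smooth, and $D\circ E=\mathrm{Id}_U$. A smooth autoencoder atlas is a collection of such charts whose domains cover $M$. Transition maps are $T_{ji}=E_j\circ D_i:E_i(U_i\cap U_j)\to E_j(U_i\cap U_j)$; linearised transition functions are $g_{ji}(x)=d(T_{ji})_{E_i(x)}\in\mathrm{GL}_d(\mathbb{R})$ for $x\in U_i\cap U_j$. The tangent bundle of the atlas is $$\mathcal{T}_{\mathcal{A}}:=\Bigl(\bigsqcup_{i\in I}U_i\times\mathbb{R}^d\Bigr)\Big/\sim,\qquad (x,v)_i\sim(x,g_{ji}(x)v)_j\ \text{ for }x\in U_i\cap U_j,\ v\in\mathbb{R}^d,$$ with the projection $[(x,v)_i]\mapsto x$. A vector bundle has transition functions $g_{ji}$ when its local trivialisations $\phi_i$ over $U_i$ satisfy $\phi_j\circ\phi_i^{-1}(x,v)=(x,g_{ji}(x)v)$. *)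

theory Defs
  imports "HOL-Analysis.Analysis" "HOL-Algebra.Module"
begin

section \<open>Smooth maps between subsets of Euclidean spaces\<close>

text \<open>For open \<open>W\<close>, membership in $C^k(W)$: all iterated directional derivatives up to
  order \<open>k\<close> exist as total derivatives and those of order \<open>k\<close> are continuous.\<close>

primrec C_diff_on :: "nat \<Rightarrow> 'a::real_normed_vector set \<Rightarrow> ('a \<Rightarrow> 'b::real_normed_vector) \<Rightarrow> bool"
where
  "C_diff_on 0 W f \<longleftrightarrow> continuous_on W f"
| "C_diff_on (Suc k) W f \<longleftrightarrow>
     (\<forall>x\<in>W. f differentiable (at x)) \<and> (\<forall>v. C_diff_on k W (\<lambda>x. frechet_derivative f (at x) v))"

text \<open>A map on an arbitrary subset is smooth if it extends, locally around each point, to a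
  $C^\infty$ map on an open subset of the ambient space. For subsets of an embedded submanifold
  that are open in it, this is smoothness for the induced smooth structure.\<close>

definition smooth_map_on :: "'a::real_normed_vector set \<Rightarrow> ('a \<Rightarrow> 'b::real_normed_vector) \<Rightarrow> bool"
where
  "smooth_map_on S f \<longleftrightarrow>
     (\<forall>x\<in>S. \<exists>W h. open W \<and> x \<in> W \<and> (\<forall>k. C_diff_on k W h) \<and> (\<forall>y\<in>S \<inter> W. h y = f y))"

definition diffeomorphism_on ::
  "'a::real_normed_vector set \<Rightarrow> 'b::real_normed_vector set \<Rightarrow> ('a \<Rightarrow> 'b) \<Rightarrow> bool"
where
  "diffeomorphism_on S T f \<longleftrightarrow>
     bij_betw f S T \<and> smooth_map_on S f \<and> smooth_map_on T (inv_into S f)"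

text \<open>Compact embedded submanifolds without boundary, of dimension \<open>CARD('d)\<close>.\<close>

definition smooth_closed_manifold :: "'d::finite itself \<Rightarrow> (real^'n) set \<Rightarrow> bool" where
  "smooth_closed_manifold TYPE('d) M \<longleftrightarrow>
     compact M \<and>
     (\<forall>x\<in>M. \<exists>U V (\<phi> :: real^'n \<Rightarrow> real^'d).
        openin (top_of_set M) U \<and> x \<in> U \<and> open V \<and> diffeomorphism_on U V \<phi>)"


section \<open>Smooth autoencoder atlases\<close>

record ('n, 'd) ae_chart =
  chart_domain :: "(real^'n) set"
  latent :: "(real^'d) set"
  encoder :: "real^'n \<Rightarrow> real^'d"
  decoder :: "real^'d \<Rightarrow> real^'n"

text \<open>The latent set $Z$ is not required to be open. Values of the encoder outside the chart
  domain and of the decoder outside the latent set are irrelevant.\<close>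

definition smooth_ae_chart :: "(real^'n) set \<Rightarrow> ('n::finite, 'd::finite) ae_chart \<Rightarrow> bool" where
  "smooth_ae_chart M c \<longleftrightarrow>
     openin (top_of_set M) (chart_domain c) \<and>
     encoder c ` chart_domain c \<subseteq> latent c \<and>
     diffeomorphism_on (chart_domain c) (encoder c ` chart_domain c) (encoder c) \<and>
     decoder c ` latent c \<subseteq> M \<and>
     smooth_map_on (latent c) (decoder c) \<and>
     (\<forall>x\<in>chart_domain c. decoder c (encoder c x) = x)"

definition smooth_ae_atlas ::
  "(real^'n) set \<Rightarrow> 'i set \<Rightarrow> ('i \<Rightarrow> ('n::finite, 'd::finite) ae_chart) \<Rightarrow> bool" where
  "smooth_ae_atlas M I A \<longleftrightarrow>
     (\<forall>i\<in>I. smooth_ae_chart M (A i)) \<and> (\<Union>i\<in>I. chart_domain (A i)) = M"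

definition transition_map ::
  "('i \<Rightarrow> ('n::finite, 'd::finite) ae_chart) \<Rightarrow> 'i \<Rightarrow> 'i \<Rightarrow> real^'d \<Rightarrow> real^'d" where
  "transition_map A j i = encoder (A j) \<circ> decoder (A i)"

text \<open>The derivative is taken within the domain $E_i(U_i \cap U_j)$ of the transition map; this
  set is open in $\mathbb{R}^d$ by invariance of domain, so the derivative there is unique.\<close>

definition linearised_transition ::
  "('i \<Rightarrow> ('n::finite, 'd::finite) ae_chart) \<Rightarrow> 'i \<Rightarrow> 'i \<Rightarrow> real^'n \<Rightarrow> real^'d^'d" where
  "linearised_transition A j i x =
     jacobian (transition_map A j i)
       (at (encoder (A i) x) within encoder (A i) ` (chart_domain (A i) \<inter> chart_domain (A j)))"


section \<open>Quotient spaces\<close>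

definition quotient_topology :: "'a topology \<Rightarrow> ('a \<times> 'a) set \<Rightarrow> 'a set topology" where
  "quotient_topology X r =
     topology (\<lambda>W. W \<subseteq> topspace X // r \<and> openin X {a \<in> topspace X. r `` {a} \<in> W})"

lemma openin_quotient_topology:
  "openin (quotient_topology X r) W \<longleftrightarrow>
     W \<subseteq> topspace X // r \<and> openin X {a \<in> topspace X. r `` {a} \<in> W}"
proof -
  have "istopology (\<lambda>W. W \<subseteq> topspace X // r \<and> openin X {a \<in> topspace X. r `` {a} \<in> W})"
    unfolding istopology_def
  proof (intro conjI allI impI)
    fix S T
    assume S: "S \<subseteq> topspace X // r \<and> openin X {a \<in> topspace X. r `` {a} \<in> S}"
      and T: "T \<subseteq> topspace X // r \<and> openin X {a \<in> topspace X. r `` {a} \<in> T}"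
    have "{a \<in> topspace X. r `` {a} \<in> S \<inter> T} =
        {a \<in> topspace X. r `` {a} \<in> S} \<inter> {a \<in> topspace X. r `` {a} \<in> T}" by blast
    with S T show "openin X {a \<in> topspace X. r `` {a} \<in> S \<inter> T}" by (simp add: openin_Int)
    show "S \<inter> T \<subseteq> topspace X // r" using S by blast
  next
    fix \<K>
    assume K: "\<forall>S\<in>\<K>. S \<subseteq> topspace X // r \<and> openin X {a \<in> topspace X. r `` {a} \<in> S}"
    have "{a \<in> topspace X. r `` {a} \<in> \<Union>\<K>} = (\<Union>S\<in>\<K>. {a \<in> topspace X. r `` {a} \<in> S})"
      by blast
    with K show "openin X {a \<in> topspace X. r `` {a} \<in> \<Union>\<K>}" by auto
    show "\<Union>\<K> \<subseteq> topspace X // r" using K by blast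
  qed
  then show ?thesis
    by (simp add: quotient_topology_def topology_inverse')
qed

lemma topspace_quotient_topology [simp]: "topspace (quotient_topology X r) = topspace X // r"
proof
  show "topspace (quotient_topology X r) \<subseteq> topspace X // r"
    using openin_quotient_topology openin_topspace by blast
  have "{a \<in> topspace X. r `` {a} \<in> topspace X // r} = topspace X"
    by (auto intro: quotientI)
  then have "openin (quotient_topology X r) (topspace X // r)"
    by (simp add: openin_quotient_topology)
  then show "topspace X // r \<subseteq> topspace (quotient_topology X r)"
    by (rule openin_subset)
qed


section \<open>The tangent bundle of an atlas\<close>

definition atlas_sum_topology ::
  "('i \<Rightarrow> ('n::finite, 'd::finite) ae_chart) \<Rightarrow> 'i set \<Rightarrow> ('i \<times> (real^'n) \<times> (real^'d)) topology"
where
  "atlas_sum_topology A I =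
     sum_topology (\<lambda>i. prod_topology (top_of_set (chart_domain (A i))) euclidean) I"

definition atlas_rel ::
  "('i \<Rightarrow> ('n::finite, 'd::finite) ae_chart) \<Rightarrow> 'i set \<Rightarrow>
     (('i \<times> (real^'n) \<times> (real^'d)) \<times> ('i \<times> (real^'n) \<times> (real^'d))) set"
where
  "atlas_rel A I =
     {((i, x, v), (j, x, linearised_transition A j i x *v v)) | i j x v.
        i \<in> I \<and> j \<in> I \<and> x \<in> chart_domain (A i) \<inter> chart_domain (A j)}"

definition atlas_tangent_bundle ::
  "('i \<Rightarrow> ('n::finite, 'd::finite) ae_chart) \<Rightarrow> 'i set \<Rightarrow> ('i \<times> (real^'n) \<times> (real^'d)) set topology"
where
  "atlas_tangent_bundle A I = quotient_topology (atlas_sum_topology A I) (atlas_rel A I)"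

definition atlas_projection :: "('i \<times> (real^'n) \<times> (real^'d)) set \<Rightarrow> real^'n" where
  "atlas_projection p = (THE x. \<exists>i v. (i, x, v) \<in> p)"

text \<open>The fibre over \<open>x\<close>, with $[(x,v)_i] + [(x,w)_i] = [(x,v+w)_i]$ and
  $c\,[(x,v)_i] = [(x,cv)_i]$. An equivalence class over \<open>x\<close> contains exactly one triple
  \<open>(i, x, v)\<close> for each chart \<open>i\<close> around \<open>x\<close>, so the operations can be carried out in all
  charts simultaneously. The ring multiplication and unit in the library's record of modules
  play no role.\<close>

definition atlas_fibre ::
  "('i \<Rightarrow> ('n::finite, 'd::finite) ae_chart) \<Rightarrow> 'i set \<Rightarrow> real^'n \<Rightarrow>
     (real, ('i \<times> (real^'n) \<times> (real^'d)) set) module"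
where
  "atlas_fibre A I x =
     \<lparr>carrier = {p \<in> topspace (atlas_tangent_bundle A I). atlas_projection p = x},
      monoid.mult = undefined, one = undefined,
      zero = {(i, x, 0) | i. i \<in> I \<and> x \<in> chart_domain (A i)},
      add = (\<lambda>p q. {(i, y, v + w) | i y v w. (i, y, v) \<in> p \<and> (i, y, w) \<in> q}),
      smult = (\<lambda>c p. {(i, y, c *\<^sub>R v) | i y v. (i, y, v) \<in> p})\<rparr>"


section \<open>Vector bundles\<close>

definition real_ring :: "real ring" where
  "real_ring = \<lparr>carrier = UNIV, monoid.mult = (*), one = 1, zero = 0, add = (+)\<rparr>"

text \<open>In the following, \<open>B\<close> is the base, \<open>X\<close> the total space, \<open>\<pi>\<close> the projection and \<open>F x\<close> the
  fibre over \<open>x\<close> together with its vector space operations. A local trivialisation is bijective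
  on fibres because it is a homeomorphism over the base.\<close>

definition local_trivialisation ::
  "'b topology \<Rightarrow> 'e topology \<Rightarrow> ('e \<Rightarrow> 'b) \<Rightarrow> ('b \<Rightarrow> (real, 'e) module) \<Rightarrow>
     'b set \<Rightarrow> ('e \<Rightarrow> 'b \<times> (real^'d::finite)) \<Rightarrow> bool"
where
  "local_trivialisation B X \<pi> F U \<phi> \<longleftrightarrow>
     openin B U \<and>
     homeomorphic_map (subtopology X {p \<in> topspace X. \<pi> p \<in> U})
       (prod_topology (subtopology B U) euclidean) \<phi> \<and>
     (\<forall>p \<in> topspace X. \<pi> p \<in> U \<longrightarrow> fst (\<phi> p) = \<pi> p) \<and>
     (\<forall>x\<in>U. \<forall>p\<in>carrier (F x). \<forall>q\<in>carrier (F x). \<forall>c.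
        snd (\<phi> (p \<oplus>\<^bsub>F x\<^esub> q)) = snd (\<phi> p) + snd (\<phi> q) \<and>
        snd (\<phi> (c \<odot>\<^bsub>F x\<^esub> p)) = c *\<^sub>R snd (\<phi> p))"

text \<open>Real vector bundles of rank \<open>CARD('d)\<close>.\<close>

definition vector_bundle ::
  "'d::finite itself \<Rightarrow> 'b topology \<Rightarrow> 'e topology \<Rightarrow> ('e \<Rightarrow> 'b) \<Rightarrow> ('b \<Rightarrow> (real, 'e) module) \<Rightarrow> bool"
where
  "vector_bundle TYPE('d) B X \<pi> F \<longleftrightarrow>
     continuous_map X B \<pi> \<and> \<pi> ` topspace X = topspace B \<and>
     (\<forall>x\<in>topspace B. carrier (F x) = {p \<in> topspace X. \<pi> p = x} \<and> Module.module real_ring (F x)) \<and>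
     (\<forall>x\<in>topspace B. \<exists>U (\<phi> :: 'e \<Rightarrow> 'b \<times> (real^'d)).
        x \<in> U \<and> local_trivialisation B X \<pi> F U \<phi>)"

definition has_transition_functions ::
  "'b topology \<Rightarrow> 'e topology \<Rightarrow> ('e \<Rightarrow> 'b) \<Rightarrow> ('b \<Rightarrow> (real, 'e) module) \<Rightarrow>
     'i set \<Rightarrow> ('i \<Rightarrow> 'b set) \<Rightarrow> ('i \<Rightarrow> 'i \<Rightarrow> 'b \<Rightarrow> real^'d^'d::finite) \<Rightarrow> bool"
where
  "has_transition_functions B X \<pi> F I U g \<longleftrightarrow>
     (\<Union>i\<in>I. U i) = topspace B \<and>
     (\<exists>\<phi>. (\<forall>i\<in>I. local_trivialisation B X \<pi> F (U i) (\<phi> i)) \<and>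
          (\<forall>i\<in>I. \<forall>j\<in>I. \<forall>x\<in>U i \<inter> U j. \<forall>v.
             \<phi> j (inv_into {p \<in> topspace X. \<pi> p \<in> U i} (\<phi> i) (x, v)) = (x, g j i x *v v)))"

text \<open>Smoothness of a vector bundle over a submanifold is smoothness of the
  $\mathrm{GL}_d(\mathbb{R})$-valued transition functions of a trivialising cover.\<close>

definition smooth_GL_valued ::
  "'i set \<Rightarrow> ('i \<Rightarrow> 'b::real_normed_vector set) \<Rightarrow> ('i \<Rightarrow> 'i \<Rightarrow> 'b \<Rightarrow> real^'d^'d::finite) \<Rightarrow> bool"
where
  "smooth_GL_valued I U g \<longleftrightarrow>
     (\<forall>i\<in>I. \<forall>j\<in>I. smooth_map_on (U i \<inter> U j) (g j i) \<and> (\<forall>x\<in>U i \<inter> U j. invertible (g j i x)))"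

end

theory Submission
  imports Defs
begin

text \<open>Invariance of domain makes the sets $E_i(V)$ open in $\mathbb{R}^d$, so the derivatives of
  the transition maps are unique and the chain rule turns $T_{ki} = T_{kj} \circ T_{ji}$ into the
  cocycle identity $g_{kj} g_{ji} = g_{ki}$. Hence an equivalence class over \<open>x\<close> has exactly one
  representative in each chart around \<open>x\<close>, and reading off this representative is a linear
  trivialisation. It is a homeomorphism because the $g_{ji}$ are continuous, and they are even
  smooth because the transition maps are.\<close>

section \<open>Calculus of iterated directional derivatives\<close>

lemma frechet_derivative_eq: "(f has_derivative f') (at x) \<Longrightarrow> frechet_derivative f (at x) = f'"
  by (metis frechet_derivative_at)

lemma has_derivative_frechet_derivative:
  "f differentiable (at x) \<Longrightarrow> (f has_derivative (\<lambda>v. frechet_derivative f (at x) v)) (at x)"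
  using frechet_derivative_works by blast

text \<open>As \<open>W\<close> is open, derivatives at its points depend only on values in
  \<open>W\<close>. So the directional derivatives of \<open>f\<close> and \<open>g\<close> agree on
  \<open>W\<close> too, and the induction runs on them.\<close>

lemma C_diff_on_cong:
  assumes "open W" "\<And>x. x \<in> W \<Longrightarrow> f x = g x" "C_diff_on k W f"
  shows "C_diff_on k W g"
  using assms(2,3)
proof (induction k arbitrary: f g)
  case 0
  then show ?case
    by (simp cong: continuous_on_cong)
next
  case (Suc k)
  have g: "(g has_derivative (\<lambda>v. frechet_derivative f (at x) v)) (at x)" if "x \<in> W" for x
    using Suc.prems that
    by (intro has_derivative_transform_within_open[OF has_derivative_frechet_derivative assms(1) that]) auto
  have "C_diff_on k W (\<lambda>x. frechet_derivative g (at x) v)" for v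
    by (rule Suc.IH[of "\<lambda>x. frechet_derivative f (at x) v"])
      (use Suc.prems in \<open>simp_all add: frechet_derivative_eq[OF g]\<close>)
  then show ?case
    using g by (auto simp: differentiable_def)
qed

text \<open>Replaces the chosen \<open>frechet_derivative\<close> by any explicit derivative
  \<open>f'\<close>. The closure properties below use it with the formulas of the sum, product and
  chain rules.\<close>

lemma C_diff_on_SucI:
  assumes "open W" "\<And>x. x \<in> W \<Longrightarrow> (f has_derivative f' x) (at x)"
    and "\<And>v. C_diff_on k W (\<lambda>x. f' x v)"
  shows "C_diff_on (Suc k) W f"
proof -
  have "C_diff_on k W (\<lambda>x. frechet_derivative f (at x) v)" for v
    by (rule C_diff_on_cong[OF assms(1) _ assms(3)[of v]]) (simp add: frechet_derivative_eq[OF assms(2)])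
  then show ?thesis
    using assms(2) by (auto simp: differentiable_def)
qed

lemma C_diff_on_imp_continuous_on: "C_diff_on k W f \<Longrightarrow> continuous_on W f"
  by (cases k) (simp_all add: continuous_at_imp_continuous_on differentiable_imp_continuous_within)

text \<open>The product and chain rules mix derivatives with undifferentiated factors. This brings
  both down to the same order, so that an induction hypothesis covers them.\<close>

lemma C_diff_on_SucD: "C_diff_on (Suc k) W f \<Longrightarrow> C_diff_on k W f"
proof (induction k arbitrary: f)
  case 0
  then show ?case by (simp only: C_diff_on.simps(1) C_diff_on_imp_continuous_on)
next
  case (Suc k)
  then show ?case unfolding C_diff_on.simps(2)[of "Suc k"] C_diff_on.simps(2)[of k] by simp
qed

lemma C_diff_on_subset: "C_diff_on k W f \<Longrightarrow> V \<subseteq> W \<Longrightarrow> C_diff_on k V f"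
  by (induction k arbitrary: f) (simp_all add: continuous_on_subset subset_eq)

lemma C_diff_on_const: "open W \<Longrightarrow> C_diff_on k W (\<lambda>x. c)"
proof (induction k arbitrary: c)
  case (Suc k)
  show ?case
    by (rule C_diff_on_SucI[where f' = "\<lambda>x v. 0"]) (use Suc in simp_all)
qed simp

lemma C_diff_on_add:
  assumes "open W" "C_diff_on k W f" "C_diff_on k W g"
  shows "C_diff_on k W (\<lambda>x. f x + g x)"
  using assms(2,3)
proof (induction k arbitrary: f g)
  case (Suc k)
  show ?case
  proof (rule C_diff_on_SucI[OF assms(1)])
    show "((\<lambda>x. f x + g x) has_derivative
        (\<lambda>v. frechet_derivative f (at x) v + frechet_derivative g (at x) v)) (at x)" if "x \<in> W" for x
      using Suc.prems that by (intro has_derivative_add has_derivative_frechet_derivative) auto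
  qed (use Suc in auto)
qed (auto intro: continuous_on_add)

lemma C_diff_on_sum:
  assumes "open W" "\<And>i. i \<in> J \<Longrightarrow> C_diff_on k W (f i)"
  shows "C_diff_on k W (\<lambda>x. \<Sum>i\<in>J. f i x)"
  using assms(2)
  by (induction J rule: infinite_finite_induct) (auto intro: C_diff_on_add C_diff_on_const assms(1))

lemma C_diff_on_bounded_linear:
  assumes "open W" "bounded_linear L" "C_diff_on k W f"
  shows "C_diff_on k W (\<lambda>x. L (f x))"
  using assms(3)
proof (induction k arbitrary: f)
  case 0
  then show ?case
    by (auto intro: bounded_linear.continuous_on[OF assms(2)])
next
  case (Suc k)
  show ?case
  proof (rule C_diff_on_SucI[OF assms(1)])
    show "((\<lambda>x. L (f x)) has_derivative (\<lambda>v. L (frechet_derivative f (at x) v))) (at x)"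
      if "x \<in> W" for x
      using Suc.prems that
      by (intro bounded_linear.has_derivative[OF assms(2)] has_derivative_frechet_derivative) auto
  qed (use Suc in auto)
qed

lemma C_diff_on_scaleR:
  fixes f :: "'a::real_normed_vector \<Rightarrow> real"
  assumes "open W" "C_diff_on k W f" "C_diff_on k W g"
  shows "C_diff_on k W (\<lambda>x. f x *\<^sub>R g x)"
  using assms(2,3)
proof (induction k arbitrary: f g)
  case (Suc k)
  show ?case
  proof (rule C_diff_on_SucI[OF assms(1)])
    show "((\<lambda>x. f x *\<^sub>R g x) has_derivative
        (\<lambda>v. f x *\<^sub>R frechet_derivative g (at x) v + frechet_derivative f (at x) v *\<^sub>R g x)) (at x)"
      if "x \<in> W" for x
      using Suc.prems that by (intro has_derivative_scaleR has_derivative_frechet_derivative) auto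
    show "C_diff_on k W
        (\<lambda>x. f x *\<^sub>R frechet_derivative g (at x) v + frechet_derivative f (at x) v *\<^sub>R g x)" for v
      using Suc.prems C_diff_on_SucD[OF Suc.prems(1)] C_diff_on_SucD[OF Suc.prems(2)]
      by (intro C_diff_on_add assms(1) Suc.IH) auto
  qed
qed (auto intro: continuous_on_scaleR)

text \<open>In the chain rule the direction in which \<open>g\<close> is differentiated varies with
  the point, whereas \<open>C_diff_on\<close> speaks of fixed directions. Expanding that direction
  along \<open>Basis\<close> leaves products of real-valued factors with derivatives of
  \<open>g\<close> in fixed directions composed with \<open>f\<close>. The induction hypothesis
  applies to the latter because \<open>g\<close> is arbitrary in it.\<close>

lemma C_diff_on_compose:
  fixes f :: "'a::real_normed_vector \<Rightarrow> 'b::euclidean_space"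
  assumes "open V" "f ` V \<subseteq> W" "C_diff_on k V f" "C_diff_on k W g"
  shows "C_diff_on k V (\<lambda>x. g (f x))"
  using assms(3,4)
proof (induction k arbitrary: g)
  case 0
  then show ?case
    using assms(2) by (auto intro: continuous_on_compose2)
next
  case (Suc k)
  let ?D = "\<lambda>x v. \<Sum>b\<in>Basis. (frechet_derivative f (at x) v \<bullet> b) *\<^sub>R frechet_derivative g (at (f x)) b"
  show ?case
  proof (rule C_diff_on_SucI[OF assms(1)])
    fix x assume x: "x \<in> V"
    then have f: "(f has_derivative (\<lambda>v. frechet_derivative f (at x) v)) (at x)"
      and g: "(g has_derivative (\<lambda>w. frechet_derivative g (at (f x)) w)) (at (f x))"
      using Suc.prems assms(2) by (auto intro!: has_derivative_frechet_derivative)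
    have "frechet_derivative g (at (f x)) w = (\<Sum>b\<in>Basis. (w \<bullet> b) *\<^sub>R frechet_derivative g (at (f x)) b)"
      for w
      using linear_sum[OF has_derivative_linear[OF g], of "\<lambda>b. (w \<bullet> b) *\<^sub>R b" Basis]
      by (simp add: euclidean_representation linear_cmul[OF has_derivative_linear[OF g]])
    then have "(\<lambda>v. frechet_derivative g (at (f x)) (frechet_derivative f (at x) v)) = ?D x"
      by blast
    then show "((\<lambda>x. g (f x)) has_derivative ?D x) (at x)"
      using has_derivative_compose[OF f g] by simp
  next
    show "C_diff_on k V (\<lambda>x. ?D x v)" for v
      using Suc.prems C_diff_on_SucD[OF Suc.prems(1)]
      by (intro C_diff_on_sum assms(1) C_diff_on_scaleR Suc.IH
          C_diff_on_bounded_linear[OF assms(1) bounded_linear_inner_left]) auto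
  qed
qed


section \<open>Smooth maps on subsets\<close>

lemma smooth_map_on_subset: "smooth_map_on S f \<Longrightarrow> T \<subseteq> S \<Longrightarrow> smooth_map_on T f"
  unfolding smooth_map_on_def by (meson Int_mono order_refl subsetD)

lemma smooth_map_on_imp_continuous_on:
  assumes "smooth_map_on S f"
  shows "continuous_on S f"
  unfolding continuous_on_eq_continuous_within
proof
  fix x assume "x \<in> S"
  then obtain W h where W: "open W" "x \<in> W" "C_diff_on 0 W h" "\<forall>y\<in>S \<inter> W. h y = f y"
    using assms unfolding smooth_map_on_def by metis
  then have "continuous_on (S \<inter> W) f"
    by (metis C_diff_on.simps(1) Int_lower2 continuous_on_cong continuous_on_subset)
  \<comment> \<open>\<open>S \<inter> W\<close> is a neighbourhood of \<open>x\<close> within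
    \<open>S\<close>, so both sets give the same filter at \<open>x\<close>.\<close>
  then show "continuous (at x within S) f"
    using W \<open>x \<in> S\<close> at_within_nhd[of x W S "S \<inter> W"]
    by (auto simp: continuous_on_eq_continuous_within continuous_within)
qed

lemma smooth_map_on_compose:
  fixes f :: "'a::real_normed_vector \<Rightarrow> 'b::euclidean_space"
  assumes "smooth_map_on S f" "smooth_map_on T g" "f ` S \<subseteq> T"
  shows "smooth_map_on S (g \<circ> f)"
  unfolding smooth_map_on_def
proof
  fix x assume x: "x \<in> S"
  obtain V f' where f': "open V" "x \<in> V" "\<And>k. C_diff_on k V f'" "\<forall>y\<in>S \<inter> V. f' y = f y"
    using assms(1) x unfolding smooth_map_on_def by metis
  obtain W g' where g': "open W" "f x \<in> W" "\<And>k. C_diff_on k W g'" "\<forall>y\<in>T \<inter> W. g' y = g y"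
    using assms(2,3) x unfolding smooth_map_on_def by (metis imageI subsetD)
  \<comment> \<open>Off \<open>S\<close> the extension \<open>f'\<close> may take values outside
    \<open>W\<close>, so its domain is shrunk until \<open>g'\<close> can be composed with
    it.\<close>
  let ?O = "V \<inter> f' -` W"
  have "open ?O"
    using f' g' by (metis C_diff_on_imp_continuous_on continuous_open_preimage)
  moreover have "x \<in> ?O"
    using f' g' x by auto
  moreover have "C_diff_on k ?O (\<lambda>y. g' (f' y))" for k
    by (rule C_diff_on_compose[OF \<open>open ?O\<close> _ _ g'(3)])
      (use C_diff_on_subset[OF f'(3)[of k], of ?O] in auto)
  moreover have "\<forall>y\<in>S \<inter> ?O. g' (f' y) = (g \<circ> f) y"
    using f' g' assms(3) by auto
  ultimately show "\<exists>W h. open W \<and> x \<in> W \<and> (\<forall>k. C_diff_on k W h) \<and> (\<forall>y\<in>S \<inter> W. h y = (g \<circ> f) y)"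
    by blast
qed

text \<open>On an open set, a local extension coincides with \<open>f\<close> on a full
  neighbourhood, so \<open>f\<close> itself inherits its derivatives.\<close>

lemma smooth_map_on_imp_C_diff_on_nhd:
  assumes "smooth_map_on S f" "open S" "x \<in> S"
  obtains W where "open W" "x \<in> W" "W \<subseteq> S" "\<And>k. C_diff_on k W f"
proof -
  obtain V h where V: "open V" "x \<in> V" "\<And>k. C_diff_on k V h" "\<forall>y\<in>S \<inter> V. h y = f y"
    using assms unfolding smooth_map_on_def by metis
  have "C_diff_on k (S \<inter> V) f" for k
    by (rule C_diff_on_cong[of _ h])
      (use C_diff_on_subset[OF V(3)[of k], of "S \<inter> V"] V assms(2) in auto)
  then show ?thesis
    using that[of "S \<inter> V"] V assms by blast
qed

lemma smooth_map_on_imp_has_derivative: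
  assumes "smooth_map_on S f" "open S" "x \<in> S"
  shows "(f has_derivative frechet_derivative f (at x)) (at x)"
proof -
  obtain W where "x \<in> W" "C_diff_on (Suc 0) W f"
    using smooth_map_on_imp_C_diff_on_nhd[OF assms] by metis
  then show ?thesis
    using has_derivative_frechet_derivative by auto
qed

lemma smooth_map_on_matrix_derivative:
  fixes f :: "real^'m::finite \<Rightarrow> real^'k::finite"
  assumes "smooth_map_on S f" "open S"
  shows "smooth_map_on S (\<lambda>x. matrix (frechet_derivative f (at x)))"
  unfolding smooth_map_on_def
proof
  fix x assume "x \<in> S"
  then obtain W where W: "open W" "x \<in> W" "W \<subseteq> S" "\<And>k. C_diff_on k W f"
    using smooth_map_on_imp_C_diff_on_nhd[OF assms] by metis
  \<comment> \<open>\<open>L b w\<close> is the matrix with column \<open>b\<close> equal to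
    \<open>w\<close> and zeros elsewhere. The Jacobian thus becomes a sum of bounded linear images
    of directional derivatives along the axes.\<close>
  define L :: "'m \<Rightarrow> real^'k \<Rightarrow> real^'m^'k" where
    "L b w = (\<chi> a c. if c = b then w $ a else 0)" for b w
  have L: "bounded_linear (L b)" for b
    unfolding linear_conv_bounded_linear[symmetric]
    by (rule linearI) (auto simp: L_def vec_eq_iff)
  have "matrix F = (\<Sum>b\<in>UNIV. L b (F (axis b 1)))" for F :: "real^'m \<Rightarrow> real^'k"
    by (simp add: matrix_def L_def vec_eq_iff sum.delta)
  moreover have "C_diff_on k W (\<lambda>x. \<Sum>b\<in>UNIV. L b (frechet_derivative f (at x) (axis b 1)))" for k
    \<comment> \<open>Order \<open>Suc k\<close> of \<open>f\<close> yields order \<open>k\<close>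
      of its derivatives.\<close>
    using W(4)[of "Suc k"] by (intro C_diff_on_sum C_diff_on_bounded_linear[OF W(1) L] W(1)) auto
  ultimately show "\<exists>W h. open W \<and> x \<in> W \<and> (\<forall>k. C_diff_on k W h) \<and>
      (\<forall>y\<in>S \<inter> W. h y = matrix (frechet_derivative f (at y)))"
    using W by auto
qed

lemma smooth_map_on_cong:
  "smooth_map_on S f \<Longrightarrow> (\<And>x. x \<in> S \<Longrightarrow> f x = g x) \<Longrightarrow> smooth_map_on S g"
  unfolding smooth_map_on_def by simp


section \<open>Modules over the reals\<close>

lemma cring_real_ring: "cring real_ring"
proof (rule cringI)
  show "abelian_group real_ring"
    by (rule abelian_groupI) (auto simp: real_ring_def intro: exI[of _ "- _"])
  show "comm_monoid real_ring"
    by (rule comm_monoidI) (auto simp: real_ring_def)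
qed (auto simp: real_ring_def algebra_simps)

text \<open>Transport of structure: each module axiom in \<open>F\<close> is the image under
  \<open>f\<close> of a vector space law. It serves for the fibre over a point, parametrised by one
  chart.\<close>

lemma module_real_ringI:
  fixes F :: "(real, 'e) module" and f :: "'v::real_vector \<Rightarrow> 'e"
  assumes carrier: "carrier F = range f"
    and zero: "\<zero>\<^bsub>F\<^esub> = f 0"
    and add: "\<And>v w. f v \<oplus>\<^bsub>F\<^esub> f w = f (v + w)"
    and smult: "\<And>c v. c \<odot>\<^bsub>F\<^esub> f v = f (c *\<^sub>R v)"
  shows "Module.module real_ring F"
proof (rule moduleI[OF cring_real_ring])
  show "abelian_group F"
  proof (rule abelian_groupI)
    fix p assume "p \<in> carrier F"
    then obtain v where "p = f v"
      using carrier by blast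
    then show "\<exists>q\<in>carrier F. q \<oplus>\<^bsub>F\<^esub> p = \<zero>\<^bsub>F\<^esub>"
      using carrier by (intro bexI[of _ "f (- v)"]) (simp_all add: add zero)
  qed (auto simp: carrier zero add ac_simps)
qed (auto simp: carrier add smult real_ring_def scaleR_add_left scaleR_add_right)


section \<open>Linearised transition functions\<close>

locale smooth_atlas =
  fixes M :: "(real^'n) set"
    and I :: "'i set"
    and A :: "'i \<Rightarrow> ('n::finite, 'd::finite) ae_chart"
  assumes manifold: "smooth_closed_manifold TYPE('d) M"
    and atlas: "smooth_ae_atlas M I A"
begin

abbreviation "U i \<equiv> chart_domain (A i)"
abbreviation "E i \<equiv> encoder (A i)"
abbreviation "D i \<equiv> decoder (A i)"
abbreviation "T \<equiv> transition_map A"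
abbreviation "g \<equiv> linearised_transition A"

lemma
  assumes "i \<in> I"
  shows openin_chart_domain: "openin (top_of_set M) (U i)"
    and smooth_encoder: "smooth_map_on (U i) (E i)"
    and inj_on_encoder: "inj_on (E i) (U i)"
    and smooth_decoder: "smooth_map_on (E i ` U i) (D i)"
    and decoder_encoder: "x \<in> U i \<Longrightarrow> D i (E i x) = x"
proof -
  have c: "smooth_ae_chart M (A i)"
    using assms atlas by (simp add: smooth_ae_atlas_def)
  then show "openin (top_of_set M) (U i)" "smooth_map_on (U i) (E i)" "inj_on (E i) (U i)"
    "x \<in> U i \<Longrightarrow> D i (E i x) = x"
    by (simp_all add: smooth_ae_chart_def diffeomorphism_on_def bij_betw_def)
  show "smooth_map_on (E i ` U i) (D i)"
    using c unfolding smooth_ae_chart_def by (elim conjE) (rule smooth_map_on_subset)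
qed

lemma Union_chart_domain: "(\<Union>i\<in>I. U i) = M"
  using atlas by (simp add: smooth_ae_atlas_def)

lemma chart_domain_subset: "i \<in> I \<Longrightarrow> U i \<subseteq> M"
  using Union_chart_domain by blast

lemma open_encoder_image:
  assumes "i \<in> I" "openin (top_of_set M) V" "V \<subseteq> U i"
  shows "open (E i ` V)"
proof (subst open_subopen, intro ballI)
  fix y assume "y \<in> E i ` V"
  then obtain x where x: "x \<in> V" "y = E i x" by blast
  then have "x \<in> M"
    using assms(2) openin_imp_subset by blast
  then obtain W O' and \<phi> :: "real^'n \<Rightarrow> real^'d" where
    W: "openin (top_of_set M) W" "x \<in> W" "open O'" and \<phi>: "diffeomorphism_on W O' \<phi>"
    using manifold unfolding smooth_closed_manifold_def by blast
  define \<psi> where "\<psi> = inv_into W \<phi>"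
  have \<psi>: "continuous_on O' \<psi>" "bij_betw \<psi> O' W"
    using \<phi> unfolding \<psi>_def diffeomorphism_on_def
    by (auto intro: smooth_map_on_imp_continuous_on bij_betw_inv_into)
  \<comment> \<open>The parameters of the points of \<open>V\<close> near \<open>x\<close>;
    restricting to \<open>V\<close> keeps \<open>\<psi>\<close> inside \<open>U i\<close>, where the
    encoder is continuous and injective.\<close>
  define S where "S = O' \<inter> \<psi> -` (W \<inter> V)"
  have "openin (top_of_set W) (W \<inter> V)"
    using W(1) assms(2) by (meson inf_le1 openin_Int openin_imp_subset openin_subset_trans)
  then have "openin (top_of_set O') S"
    unfolding S_def using \<psi> by (intro continuous_openin_preimage) (auto simp: bij_betw_def)
  then have "open S"
    using W(3) openin_open_trans by blast
  have im: "\<psi> ` S = W \<inter> V"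
    using \<psi>(2) unfolding S_def bij_betw_def by blast
  have "continuous_on S (E i \<circ> \<psi>)"
  proof (rule continuous_on_compose)
    show "continuous_on S \<psi>"
      using \<psi>(1) by (rule continuous_on_subset) (auto simp: S_def)
    show "continuous_on (\<psi> ` S) (E i)"
      using smooth_map_on_imp_continuous_on[OF smooth_encoder[OF assms(1)]]
      by (rule continuous_on_subset) (use im assms(3) in auto)
  qed
  moreover have "inj_on (E i \<circ> \<psi>) S"
  proof (rule comp_inj_on)
    show "inj_on \<psi> S"
      using \<psi>(2) by (auto simp: S_def bij_betw_def inj_on_def)
    show "inj_on (E i) (\<psi> ` S)"
      using inj_on_encoder[OF assms(1)] im assms(3) by (auto simp: inj_on_def)
  qed
  ultimately have "open ((E i \<circ> \<psi>) ` S)"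
    using \<open>open S\<close> by (intro invariance_of_domain)
  then have "open (E i ` (W \<inter> V))"
    by (metis im image_comp)
  then show "\<exists>T. open T \<and> y \<in> T \<and> T \<subseteq> E i ` V"
    using x W by blast
qed

section \<open>Transition maps and their derivatives\<close>

lemma openin_overlap:
  "i \<in> I \<Longrightarrow> j \<in> I \<Longrightarrow> openin (top_of_set M) (U i \<inter> U j)"
  by (simp add: openin_Int openin_chart_domain)

lemma open_encoder_overlap: "i \<in> I \<Longrightarrow> j \<in> I \<Longrightarrow> open (E i ` (U i \<inter> U j))"
  by (simp add: open_encoder_image openin_overlap)

lemma transition_map_encoder: "i \<in> I \<Longrightarrow> x \<in> U i \<Longrightarrow> T j i (E i x) = E j x"
  by (simp add: transition_map_def decoder_encoder)

lemma smooth_transition_map: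
  assumes "i \<in> I" "j \<in> I"
  shows "smooth_map_on (E i ` (U i \<inter> U j)) (T j i)"
  unfolding transition_map_def
proof (rule smooth_map_on_compose)
  show "smooth_map_on (E i ` (U i \<inter> U j)) (D i)"
    using smooth_decoder[OF assms(1)] by (rule smooth_map_on_subset) auto
qed (use assms smooth_encoder decoder_encoder in auto)

text \<open>At a point of an open set, the derivative within the set is the ordinary
  derivative.\<close>

lemma linearised_transition_eq:
  assumes "i \<in> I" "j \<in> I" "x \<in> U i \<inter> U j"
  shows "g j i x = matrix (frechet_derivative (T j i) (at (E i x)))"
  using assms at_within_open[OF _ open_encoder_overlap[OF assms(1,2)], of "E i x"]
  by (simp add: linearised_transition_def jacobian_def)

lemma transition_map_has_derivative:
  assumes "i \<in> I" "j \<in> I" "x \<in> U i \<inter> U j"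
  shows "(T j i has_derivative (*v) (g j i x)) (at (E i x))"
proof -
  have *: "(T j i has_derivative frechet_derivative (T j i) (at (E i x))) (at (E i x))"
    using assms
    by (intro smooth_map_on_imp_has_derivative[OF smooth_transition_map open_encoder_overlap]) auto
  then have "(*v) (g j i x) = frechet_derivative (T j i) (at (E i x))"
    using matrix_works[of "frechet_derivative (T j i) (at (E i x))"] has_derivative_linear
    by (auto simp: linearised_transition_eq[OF assms])
  with * show ?thesis by simp
qed

lemma linearised_transition_cocycle:
  assumes "i \<in> I" "j \<in> I" "k \<in> I" "x \<in> U i" "x \<in> U j" "x \<in> U k"
  shows "g k j x *v (g j i x *v v) = g k i x *v v"
proof -
  have "(T j i has_derivative (*v) (g j i x)) (at (E i x))"
    using assms by (intro transition_map_has_derivative) auto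
  moreover have "(T k j has_derivative (*v) (g k j x)) (at (T j i (E i x)))"
    using transition_map_has_derivative[of j k x] assms by (simp add: transition_map_encoder)
  ultimately have "((\<lambda>y. T k j (T j i y)) has_derivative (\<lambda>v. g k j x *v (g j i x *v v))) (at (E i x))"
    by (rule has_derivative_compose)
  \<comment> \<open>\<open>T k j (T j i y)\<close> is known to equal \<open>T k i y\<close> only for
    \<open>y\<close> in the image of the triple overlap. That image is open, so the derivative at
    \<open>E i x\<close> carries over.\<close>
  moreover have "open (E i ` (U i \<inter> (U j \<inter> U k)))"
    using assms by (intro open_encoder_image openin_Int openin_chart_domain) auto
  ultimately have "(T k i has_derivative (\<lambda>v. g k j x *v (g j i x *v v))) (at (E i x))"
    by (rule has_derivative_transform_within_open) (use assms in \<open>auto simp: transition_map_encoder\<close>)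
  moreover have "(T k i has_derivative (*v) (g k i x)) (at (E i x))"
    using assms by (intro transition_map_has_derivative) auto
  ultimately show ?thesis
    by (metis has_derivative_unique)
qed

lemma linearised_transition_self:
  assumes "i \<in> I" "x \<in> U i"
  shows "g i i x *v v = v"
proof -
  have "(T i i has_derivative (\<lambda>v. v)) (at (E i x))"
  proof (rule has_derivative_transform_within_open)
    show "((\<lambda>y. y) has_derivative (\<lambda>v. v)) (at (E i x))" by simp
    show "open (E i ` (U i \<inter> U i))"
      using assms(1) by (intro open_encoder_overlap)
  qed (use assms in \<open>auto simp: transition_map_encoder\<close>)
  moreover have "(T i i has_derivative (*v) (g i i x)) (at (E i x))"
    using assms by (intro transition_map_has_derivative) auto
  ultimately show ?thesis
    by (metis has_derivative_unique)
qed

text \<open>The cocycle identity along \<open>i, j, i\<close> and along \<open>j, i, j\<close>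
  exhibits \<open>g i j x\<close> as a two-sided inverse.\<close>

lemma invertible_linearised_transition:
  assumes "i \<in> I" "j \<in> I" "x \<in> U i \<inter> U j"
  shows "invertible (g j i x)"
proof -
  have "g i j x ** g j i x = mat 1" "g j i x ** g i j x = mat 1"
    using assms linearised_transition_cocycle[of i j i x] linearised_transition_cocycle[of j i j x]
      linearised_transition_self
    by (auto simp: matrix_eq matrix_vector_mul_assoc[symmetric])
  then show ?thesis
    by (auto simp: invertible_def)
qed

lemma smooth_linearised_transition:
  assumes "i \<in> I" "j \<in> I"
  shows "smooth_map_on (U i \<inter> U j) (g j i)"
proof (rule smooth_map_on_cong)
  show "smooth_map_on (U i \<inter> U j) ((\<lambda>y. matrix (frechet_derivative (T j i) (at y))) \<circ> E i)"
  proof (rule smooth_map_on_compose)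
    show "smooth_map_on (U i \<inter> U j) (E i)"
      using smooth_encoder[OF assms(1)] by (rule smooth_map_on_subset) auto
    show "smooth_map_on (E i ` (U i \<inter> U j)) (\<lambda>y. matrix (frechet_derivative (T j i) (at y)))"
      using assms by (intro smooth_map_on_matrix_derivative smooth_transition_map open_encoder_overlap)
  qed simp
qed (simp add: linearised_transition_eq[OF assms])

lemma smooth_GL_valued_linearised_transition: "smooth_GL_valued I U g"
  by (simp add: smooth_GL_valued_def smooth_linearised_transition invertible_linearised_transition)


section \<open>The quotient bundle\<close>

abbreviation "Q \<equiv> atlas_tangent_bundle A I"

section \<open>Equivalence classes and their representatives\<close>

definition cls :: "'i \<Rightarrow> real^'n \<Rightarrow> real^'d \<Rightarrow> ('i \<times> (real^'n) \<times> (real^'d)) set" where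
  "cls i x v = atlas_rel A I `` {(i, x, v)}"

lemma cls_eq:
  assumes "i \<in> I" "x \<in> U i"
  shows "cls i x v = {(j, x, g j i x *v v) | j. j \<in> I \<and> x \<in> U j}"
  using assms by (auto simp: cls_def atlas_rel_def)

text \<open>By the cocycle identity both classes list the same representative in every chart. This
  does the work of symmetry and transitivity of the relation.\<close>

lemma cls_change_chart:
  assumes "i \<in> I" "j \<in> I" "x \<in> U i" "x \<in> U j"
  shows "cls j x (g j i x *v v) = cls i x v"
  using assms linearised_transition_cocycle[OF assms(1,2)] by (auto simp: cls_eq)

text \<open>Uniqueness of the representative in chart \<open>i\<close>, from \<open>g i i x\<close>
  being the identity. It makes the description in \<open>triv\<close> well defined.\<close>

lemma mem_cls_iff:
  assumes "i \<in> I" "x \<in> U i"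
  shows "(i, y, w) \<in> cls i x v \<longleftrightarrow> y = x \<and> w = v"
  using assms by (auto simp: cls_eq linearised_transition_self)

lemma atlas_projection_cls [simp]:
  assumes "i \<in> I" "x \<in> U i"
  shows "atlas_projection (cls i x v) = x"
  unfolding atlas_projection_def
  by (rule the_equality) (use assms in \<open>auto simp: cls_eq\<close>)

lemma topspace_bundle: "topspace Q = {cls i x v | i x v. i \<in> I \<and> x \<in> U i}"
  unfolding cls_def by (simp add: atlas_tangent_bundle_def atlas_sum_topology_def quotient_def o_def) blast

lemma cls_in_topspace: "i \<in> I \<Longrightarrow> x \<in> U i \<Longrightarrow> cls i x v \<in> topspace Q"
  by (auto simp: topspace_bundle)

lemma bundle_point_cases:
  assumes "p \<in> topspace Q" "atlas_projection p \<in> U i" "i \<in> I"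
  obtains v where "p = cls i (atlas_projection p) v"
proof -
  obtain j x v where p: "p = cls j x v" "j \<in> I" "x \<in> U j"
    using assms(1) by (auto simp: topspace_bundle)
  then have "p = cls i (atlas_projection p) (g i j x *v v)"
    using assms by (simp add: cls_change_chart)
  with that show ?thesis .
qed

section \<open>Quotient topology and candidate trivialisations\<close>

lemma openin_bundle:
  "openin Q W \<longleftrightarrow> W \<subseteq> topspace Q \<and>
     (\<forall>i\<in>I. openin (top_of_set (U i \<times> UNIV)) {(x, v). x \<in> U i \<and> cls i x v \<in> W})"
proof -
  have "prod_topology (top_of_set (U i)) euclidean = top_of_set (U i \<times> (UNIV :: (real^'d) set))" for i
    using prod_topology_subtopology_eu[of "U i" "UNIV :: (real^'d) set"] by simp
  moreover have "{y. (i, y) \<in> Sigma I (\<lambda>i. U i \<times> UNIV) \<and> atlas_rel A I `` {(i, y)} \<in> W} =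
      {(x, v). x \<in> U i \<and> cls i x v \<in> W}" if "i \<in> I" for i
    using that by (auto simp: cls_def)
  moreover have "topspace Q = Sigma I (\<lambda>i. U i \<times> UNIV) // atlas_rel A I"
    by (simp add: atlas_tangent_bundle_def atlas_sum_topology_def o_def)
  ultimately show ?thesis
    unfolding atlas_tangent_bundle_def openin_quotient_topology atlas_sum_topology_def
      openin_sum_topology
    by (auto simp: o_def)
qed

lemma continuous_map_cls:
  assumes "i \<in> I"
  shows "continuous_map (top_of_set (U i \<times> UNIV)) Q (\<lambda>(x, v). cls i x v)"
  unfolding continuous_map_def
proof (intro conjI allI impI)
  show "(\<lambda>(x, v). cls i x v) \<in> topspace (top_of_set (U i \<times> UNIV)) \<rightarrow> topspace Q"
    using assms by (auto intro: cls_in_topspace)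
next
  fix W assume "openin Q W"
  then have "openin (top_of_set (U i \<times> UNIV)) {(x, v). x \<in> U i \<and> cls i x v \<in> W}"
    using assms by (simp add: openin_bundle)
  also have "{(x, v). x \<in> U i \<and> cls i x v \<in> W} =
      {y \<in> topspace (top_of_set (U i \<times> UNIV)). (case y of (x, v) \<Rightarrow> cls i x v) \<in> W}"
    by auto
  finally show "openin (top_of_set (U i \<times> UNIV)) \<dots>" .
qed

text \<open>Reads off the coordinate of a class in chart \<open>i\<close>. The value is meaningful
  only over \<open>U i\<close>; elsewhere no representative in that chart exists.\<close>

definition triv :: "'i \<Rightarrow> ('i \<times> (real^'n) \<times> (real^'d)) set \<Rightarrow> (real^'n) \<times> (real^'d)" where
  "triv i p = (atlas_projection p, THE v. (i, atlas_projection p, v) \<in> p)"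

text \<open>Says that \<open>triv i\<close> inverts the parametrisation of classes by chart
  \<open>i\<close>.\<close>

lemma triv_cls [simp]: "i \<in> I \<Longrightarrow> x \<in> U i \<Longrightarrow> triv i (cls i x v) = (x, v)"
  by (simp add: triv_def mem_cls_iff)

lemma triv_cls':
  assumes "i \<in> I" "j \<in> I" "x \<in> U i" "x \<in> U j"
  shows "triv j (cls i x v) = (x, g j i x *v v)"
  using assms triv_cls cls_change_chart by metis

lemma continuous_on_linearised_transition_mult:
  assumes "i \<in> I" "j \<in> I"
  shows "continuous_on ((U i \<inter> U j) \<times> UNIV) (\<lambda>(x, v). (x, g j i x *v v))"
proof -
  have "continuous_on ((U i \<inter> U j) \<times> UNIV) (\<lambda>y :: (real^'n) \<times> (real^'d). g j i (fst y))"
    by (rule continuous_on_compose2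
        [OF smooth_map_on_imp_continuous_on[OF smooth_linearised_transition[OF assms]]])
      (auto intro: continuous_intros)
  then show ?thesis
    \<comment> \<open>Componentwise the product is a finite sum of entries of \<open>g j i\<close>
      times coordinates of \<open>v\<close>, which gives joint continuity.\<close>
    unfolding case_prod_unfold matrix_vector_mult_def
    by (intro continuous_intros)
qed

text \<open>Seen from chart \<open>j\<close>, the set is the preimage of \<open>W\<close> under the
  continuous change of coordinates from \<open>j\<close> to \<open>i\<close>, on an open part of
  \<open>U j \<times> UNIV\<close>. Both \<open>triv i\<close> and the projection get their
  continuity from this.\<close>

lemma openin_triv_preimage:
  assumes "i \<in> I" "openin (top_of_set (U i \<times> UNIV)) W"
  shows "openin Q {p \<in> topspace Q. atlas_projection p \<in> U i \<and> triv i p \<in> W}"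
  unfolding openin_bundle
proof (intro conjI ballI)
  fix j assume j: "j \<in> I"
  let ?S = "(U j \<inter> U i) \<times> (UNIV :: (real^'d) set)"
  have "openin (top_of_set (U j)) (U j \<inter> U i)"
    using openin_overlap[OF j assms(1)] chart_domain_subset[OF j]
    by (meson inf_le1 openin_subset_trans)
  then have "openin (top_of_set (U j \<times> UNIV)) ?S"
    by (simp add: openin_Times)
  moreover have "openin (top_of_set ?S) (?S \<inter> (\<lambda>(x, v). (x, g i j x *v v)) -` W)"
    by (rule continuous_openin_preimage
        [OF continuous_on_linearised_transition_mult[OF j assms(1)] _ assms(2)]) auto
  ultimately have "openin (top_of_set (U j \<times> UNIV)) (?S \<inter> (\<lambda>(x, v). (x, g i j x *v v)) -` W)"
    by (rule openin_trans[rotated])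
  also have "?S \<inter> (\<lambda>(x, v). (x, g i j x *v v)) -` W =
      {(x, v). x \<in> U j \<and> cls j x v \<in> {p \<in> topspace Q. atlas_projection p \<in> U i \<and> triv i p \<in> W}}"
    using assms(1) j by (auto simp: triv_cls' intro: cls_in_topspace)
  finally show "openin (top_of_set (U j \<times> UNIV)) \<dots>" .
qed auto

section \<open>Linear structure of the fibres\<close>

lemma carrier_atlas_fibre:
  "carrier (atlas_fibre A I x) = {p \<in> topspace Q. atlas_projection p = x}"
  by (simp add: atlas_fibre_def)

lemma carrier_atlas_fibre_eq_range:
  assumes "i \<in> I" "x \<in> U i"
  shows "carrier (atlas_fibre A I x) = range (cls i x)"
proof
  show "carrier (atlas_fibre A I x) \<subseteq> range (cls i x)"
  proof
    fix p assume "p \<in> carrier (atlas_fibre A I x)"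
    then have "p \<in> topspace Q" "atlas_projection p = x"
      by (simp_all add: carrier_atlas_fibre)
    with assms obtain v where "p = cls i x v"
      by (metis bundle_point_cases)
    then show "p \<in> range (cls i x)"
      by blast
  qed
  show "range (cls i x) \<subseteq> carrier (atlas_fibre A I x)"
    using assms by (auto simp: carrier_atlas_fibre cls_in_topspace)
qed

text \<open>The fibre operations act in all charts at once. The results are again single classes
  because every \<open>g j i x\<close> acts linearly.\<close>

lemma atlas_fibre_ops:
  assumes "i \<in> I" "x \<in> U i"
  shows "\<zero>\<^bsub>atlas_fibre A I x\<^esub> = cls i x 0"
    and "cls i x v \<oplus>\<^bsub>atlas_fibre A I x\<^esub> cls i x w = cls i x (v + w)"
    and "c \<odot>\<^bsub>atlas_fibre A I x\<^esub> cls i x v = cls i x (c *\<^sub>R v)"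
  using assms
  by (auto simp: atlas_fibre_def cls_eq matrix_vector_right_distrib matrix_vector_mult_scaleR
      matrix_vector_mult_0_right)

section \<open>Local triviality, bundle axioms and transition functions\<close>

lemma cls_triv:
  assumes "i \<in> I" "p \<in> topspace Q" "atlas_projection p \<in> U i"
  shows "(\<lambda>(x, v). cls i x v) (triv i p) = p" "triv i p \<in> U i \<times> UNIV"
proof -
  obtain v where v: "p = cls i (atlas_projection p) v"
    using bundle_point_cases assms by blast
  with assms have "triv i p = (atlas_projection p, v)"
    by (metis triv_cls)
  with v assms show "(\<lambda>(x, v). cls i x v) (triv i p) = p" "triv i p \<in> U i \<times> UNIV"
    by simp_all
qed

lemma local_trivialisation_triv:
  assumes "i \<in> I"
  shows "local_trivialisation (top_of_set M) Q atlas_projection (atlas_fibre A I) (U i) (triv i)"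
  unfolding local_trivialisation_def
proof (intro conjI)
  let ?P = "{p \<in> topspace Q. atlas_projection p \<in> U i}"
  note inv = cls_triv[OF assms]
  have homeo: "homeomorphic_maps (subtopology Q ?P) (top_of_set (U i \<times> UNIV)) (triv i) (\<lambda>(x, v). cls i x v)"
    unfolding homeomorphic_maps_def
  proof (intro conjI ballI)
    show "continuous_map (subtopology Q ?P) (top_of_set (U i \<times> UNIV)) (triv i)"
      unfolding continuous_map_def
    proof (intro conjI allI impI)
      show "triv i \<in> topspace (subtopology Q ?P) \<rightarrow> topspace (top_of_set (U i \<times> UNIV))"
        using inv by auto
    next
      fix W assume "openin (top_of_set (U i \<times> (UNIV :: (real^'d) set))) W"
      then have "openin Q {p \<in> topspace Q. atlas_projection p \<in> U i \<and> triv i p \<in> W}"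
        by (rule openin_triv_preimage[OF assms])
      then show "openin (subtopology Q ?P) {p \<in> topspace (subtopology Q ?P). triv i p \<in> W}"
        unfolding openin_subtopology by auto
    qed
    show "continuous_map (top_of_set (U i \<times> UNIV)) (subtopology Q ?P) (\<lambda>(x, v). cls i x v)"
      using continuous_map_cls[OF assms] assms
      by (auto simp: continuous_map_in_subtopology cls_in_topspace)
  qed (use inv assms in auto)
  have prod: "prod_topology (subtopology (top_of_set M) (U i)) euclidean =
      top_of_set (U i \<times> (UNIV :: (real^'d) set))"
    using prod_topology_subtopology_eu[of "U i" "UNIV :: (real^'d) set"] chart_domain_subset[OF assms]
    by (simp add: subtopology_subtopology Int_absorb1)
  show "homeomorphic_map (subtopology Q ?P)
      (prod_topology (subtopology (top_of_set M) (U i)) euclidean) (triv i)"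
    unfolding prod using homeo by (rule homeomorphic_maps_imp_map)
  show "\<forall>x\<in>U i. \<forall>p\<in>carrier (atlas_fibre A I x). \<forall>q\<in>carrier (atlas_fibre A I x). \<forall>c.
      snd (triv i (p \<oplus>\<^bsub>atlas_fibre A I x\<^esub> q)) = snd (triv i p) + snd (triv i q) \<and>
      snd (triv i (c \<odot>\<^bsub>atlas_fibre A I x\<^esub> p)) = c *\<^sub>R snd (triv i p)"
    using assms by (auto simp: carrier_atlas_fibre_eq_range[OF assms] atlas_fibre_ops)
qed (use openin_chart_domain[OF assms] in \<open>simp_all add: triv_def\<close>)

lemma vector_bundle_atlas:
  "vector_bundle TYPE('d) (top_of_set M) Q atlas_projection (atlas_fibre A I)"
  unfolding vector_bundle_def
proof (intro conjI ballI)
  \<comment> \<open>The preimage of \<open>V\<close> is cut along the chart domains. On each piece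
    the projection is the first component of \<open>triv i\<close>, so
    \<open>openin_triv_preimage\<close> applies to the cylinder over
    \<open>U i \<inter> V\<close>.\<close>
  have "{p \<in> topspace Q. atlas_projection p \<in> V} =
      (\<Union>i\<in>I. {p \<in> topspace Q. atlas_projection p \<in> U i \<and> triv i p \<in> (U i \<inter> V) \<times> UNIV})" for V
    by (fastforce simp: triv_def topspace_bundle)
  moreover have "openin Q {p \<in> topspace Q. atlas_projection p \<in> U i \<and> triv i p \<in> (U i \<inter> V) \<times> UNIV}"
    if "openin (top_of_set M) V" "i \<in> I" for V i
  proof (rule openin_triv_preimage[OF that(2)])
    have "openin (top_of_set (U i)) (U i \<inter> V)"
      using that openin_chart_domain chart_domain_subset
      by (meson inf_le1 openin_Int openin_subset_trans)
    then show "openin (top_of_set (U i \<times> UNIV)) ((U i \<inter> V) \<times> (UNIV :: (real^'d) set))"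
      by (simp add: openin_Times)
  qed
  ultimately show "continuous_map Q (top_of_set M) atlas_projection"
    using Union_chart_domain by (auto simp: continuous_map_def topspace_bundle)
next
  show "atlas_projection ` topspace Q = topspace (top_of_set M)"
  proof
    show "atlas_projection ` topspace Q \<subseteq> topspace (top_of_set M)"
      by (auto simp: topspace_bundle intro: subsetD[OF chart_domain_subset])
    show "topspace (top_of_set M) \<subseteq> atlas_projection ` topspace Q"
    proof
      fix x assume "x \<in> topspace (top_of_set M)"
      then obtain i where i: "i \<in> I" "x \<in> U i"
        using Union_chart_domain by auto
      show "x \<in> atlas_projection ` topspace Q"
        by (rule image_eqI[of _ _ "cls i x 0"]) (simp_all add: i cls_in_topspace)
    qed
  qed
next
  fix x assume "x \<in> topspace (top_of_set M)"
  then obtain i where i: "i \<in> I" "x \<in> U i"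
    using Union_chart_domain by auto
  show "carrier (atlas_fibre A I x) = {p \<in> topspace Q. atlas_projection p = x}"
    by (rule carrier_atlas_fibre)
  show "Module.module real_ring (atlas_fibre A I x)"
    \<comment> \<open>Any chart around \<open>x\<close> parametrises the whole fibre
      linearly.\<close>
    by (rule module_real_ringI[of _ "cls i x"])
      (use i in \<open>simp_all add: carrier_atlas_fibre_eq_range atlas_fibre_ops\<close>)
  show "\<exists>U (\<phi> :: _ \<Rightarrow> (real^'n) \<times> (real^'d)). x \<in> U \<and>
      local_trivialisation (top_of_set M) Q atlas_projection (atlas_fibre A I) U \<phi>"
    using i local_trivialisation_triv by blast
qed

lemma has_transition_functions_atlas:
  "has_transition_functions (top_of_set M) Q atlas_projection (atlas_fibre A I) I U g"
  unfolding has_transition_functions_def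
proof (intro conjI exI[of _ triv] ballI allI)
  show "(\<Union>i\<in>I. U i) = topspace (top_of_set M)"
    by (simp add: Union_chart_domain)
next
  fix i j x v assume ij: "i \<in> I" "j \<in> I" and x: "x \<in> U i \<inter> U j"
  \<comment> \<open>Injectivity pins \<open>inv_into\<close> down to the parametrisation by
    \<open>cls i\<close>; reading the result in chart \<open>j\<close> then produces
    \<open>g j i x\<close>.\<close>
  have "inj_on (triv i) {p \<in> topspace Q. atlas_projection p \<in> U i}"
    by (rule inj_on_inverseI[of _ "\<lambda>(x, v). cls i x v"]) (simp add: cls_triv(1) ij(1))
  then have "inv_into {p \<in> topspace Q. atlas_projection p \<in> U i} (triv i) (x, v) = cls i x v"
    using ij x by (intro inv_into_f_eq) (auto intro: cls_in_topspace)
  then show "triv j (inv_into {p \<in> topspace Q. atlas_projection p \<in> U i} (triv i) (x, v)) =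
      (x, g j i x *v v)"
    using ij x by (simp add: triv_cls')
qed (rule local_trivialisation_triv)

end


theorem corollary3p13:
  fixes M :: "(real^'n) set"
    and I :: "'i set"
    and A :: "'i \<Rightarrow> ('n::finite, 'd::finite) ae_chart"
  assumes "smooth_closed_manifold TYPE('d) M"
    and "smooth_ae_atlas M I A"
  shows "vector_bundle TYPE('d) (top_of_set M) (atlas_tangent_bundle A I)
           atlas_projection (atlas_fibre A I) \<and>
         has_transition_functions (top_of_set M) (atlas_tangent_bundle A I)
           atlas_projection (atlas_fibre A I) I (\<lambda>i. chart_domain (A i)) (linearised_transition A) \<and>
         smooth_GL_valued I (\<lambda>i. chart_domain (A i)) (linearised_transition A)"
proof -
  interpret smooth_atlas M I A
    using assms by unfold_locales
  show ?thesis
    using vector_bundle_atlas has_transition_functions_atlas smooth_GL_valued_linearised_transition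
    by blast
qed

end
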